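(* Let $f\in\mathcal{S}$ or $f\in\mathcal{U}$. Then $$\left|\frac{(\zeta-u)^2 f'(\zeta)f'(u)}{(f(u)-f(\zeta))^2}-1\right|<1\quad\text{for all } \zeta,u \text{ with } |\zeta|<\sqrt2-1,\ |u|<\sqrt2-1.$$ The result is best possible in both cases: for each of the two classes $\mathcal{F}=\mathcal{S}$ and $\mathcal{F}=\mathcal{U}$, there is no $R$ with $\sqrt2-1<R\le 1$ such that the inequality $$\left|\frac{(\zeta-u)^2 f'(\zeta)f'(u)}{(f(u)-f(\zeta))^2}-1\right|<1$$ holds for all $f\in\mathcal{F}$ and all $\zeta,u$ with $|\zeta|<R$, $|u|<R$.
   Context: $\mathbb{D}=\{z\in\mathbb{C}: |z|<1\}$. $\mathcal{A}$ is the family of functions $f$ analytic in $\mathbb{D}$ with $f(0)=0$ and $f'(0)=1$. $\mathcal{S}$ is the subclass of $\mathcal{A}$ consisting of univalent (injective) functions in $\mathbb{D}$. $\mathcal{U}$ is the subclass of those $f\in\mathcal{S}$ such that $$\left|\left(\frac{z}{f(z)}\right)^2 f'(z)-1\right|<1\quad\text{for all } z\in\mathbb{D},$$ where $z/f(z)$ is given its limit value $1$ at $z=0$. When $u=\zeta$, the quotient $\frac{(\zeta-u)^2 f'(\zeta)f'(u)}{(f(u)-f(\zeta))^2}$ is understood as its limit value $1$. *)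

theory Defs
  imports "HOL-Analysis.Analysis"
begin

(* Functions on the unit disc are represented by total functions on the complex plane whose
   values outside the disc are irrelevant: the disc is open, so deriv at a point of the disc
   depends only on the values inside. *)

definition class_A :: "(complex \<Rightarrow> complex) set" where
  "class_A = {f. f analytic_on ball 0 1 \<and> f 0 = 0 \<and> deriv f 0 = 1}"

definition class_S :: "(complex \<Rightarrow> complex) set" where
  "class_S = {f \<in> class_A. inj_on f (ball 0 1)}"

(* z / f z with its removable singularity at 0 filled in by the limit value. *)
definition quot_id :: "(complex \<Rightarrow> complex) \<Rightarrow> complex \<Rightarrow> complex" where
  "quot_id f z = (if z = 0 then 1 else z / f z)"

definition class_U :: "(complex \<Rightarrow> complex) set" where
  "class_U = {f \<in> class_S. \<forall>z \<in> ball 0 1. cmod ((quot_id f z)\<^sup>2 * deriv f z - 1) < 1}"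

(* The value 1 on the diagonal is the limit of the quotient there. *)
definition two_point_quot :: "(complex \<Rightarrow> complex) \<Rightarrow> complex \<Rightarrow> complex \<Rightarrow> complex" where
  "two_point_quot f \<zeta> u =
     (if u = \<zeta> then 1
      else (\<zeta> - u)\<^sup>2 * deriv f \<zeta> * deriv f u / (f u - f \<zeta>)\<^sup>2)"

end

theory Submission
  imports Defs "HOL-Complex_Analysis.Complex_Analysis"
begin

text \<open>
  The two-point quotient is invariant under composing \<open>f\<close> on the outside with affine maps and
  transforms like \<open>1 / (\<zeta> - u)\<^sup>2\<close> under automorphisms of the disc. A Koebe transform moving \<open>\<zeta>\<close> to \<open>0\<close>
  therefore turns it into \<open>z\<^sup>2 F'(z) / F(z)\<^sup>2\<close> for a normalised univalent \<open>F\<close>. With \<open>1 / F = 1 / z + k\<close> this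
  is \<open>1 - z\<^sup>2 k'(z)\<close>, and the area theorem for \<open>1 / F\<close> together with Cauchy-Schwarz bounds \<open>k'\<close>.
  The resulting bound is less than \<open>1\<close> as soon as \<open>\<bar>\<zeta> - u\<bar>\<^sup>2 < (1 - \<bar>\<zeta>\<bar>\<^sup>2) (1 - \<bar>u\<bar>\<^sup>2)\<close>.

  The area theorem is obtained without Green's formula: the image of \<open>\<rho> < \<bar>z\<bar> < r\<close> under
  \<open>1 / z + k\<close> lies inside an ellipse of area \<open>\<pi> / \<rho>\<^sup>2 + O(\<rho>)\<close>, while its area is bounded below by a
  change of variables to logarithmic coordinates and Bessel's inequality on circles.

  Sharpness for both classes is witnessed by \<open>z / (1 - z\<^sup>2)\<close> at \<open>\<zeta> = r\<close>, \<open>u = - r\<close>.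
\<close>

section \<open>Means over circles: mean value property and Bessel's inequality\<close>

text \<open>Cauchy's integral formula at the centre, in angular form; it makes the cross term in
  Bessel's inequality vanish.\<close>

lemma circle_mean_value:
  fixes f :: "complex \<Rightarrow> complex"
  assumes f: "f holomorphic_on ball 0 1" and s: "0 < s" "s < 1"
  shows "((\<lambda>y. f (of_real s * cis y)) has_integral 2 * of_real pi * f 0) {0..2*pi}"
proof -
  have "((\<lambda>u. f u / (u - 0)) has_contour_integral (2 * of_real pi * \<i> * f 0)) (circlepath 0 s)"
  proof (rule Cauchy_integral_circlepath)
    have "cball (0::complex) s \<subseteq> ball 0 1" using s by auto
    then show "continuous_on (cball 0 s) f"
      using f holomorphic_on_imp_continuous_on continuous_on_subset by blast
    show "f holomorphic_on ball 0 s" using f s by (auto intro: holomorphic_on_subset)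
  qed (use s in auto)
  then have "((\<lambda>t. f (of_real s * cis t) / (of_real s * cis t) * of_real s * \<i> * cis t)
       has_integral (2 * of_real pi * \<i> * f 0)) {0..2*pi}"
    unfolding circlepath_def by (subst (asm) has_contour_integral_part_circlepath_iff) auto
  then have "((\<lambda>t. f (of_real s * cis t) * \<i>) has_integral (2 * of_real pi * \<i> * f 0)) {0..2*pi}"
    using s by (simp add: field_simps)
  from has_integral_mult_right[OF this, of "-\<i>"] show ?thesis
    by (simp add: algebra_simps)
qed

text \<open>Induction peels off the constant coefficient: with f = a 0 + z f1, the cross term has
  mean zero on the circle, so the integral of |f|^2 is 2 pi |a 0|^2 plus s^2 times that of
  |f1|^2.\<close>

lemma power_series_Bessel_circle:
  fixes a :: "nat \<Rightarrow> complex"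
  assumes "\<And>z. z \<in> ball 0 1 \<Longrightarrow> (\<lambda>n. a n * z ^ n) sums f z" and s: "0 < s" "s < 1"
  shows "2 * pi * (\<Sum>n<N. (cmod (a n))\<^sup>2 * s ^ (2 * n)) \<le>
           integral {0..2*pi} (\<lambda>y. (cmod (f (of_real s * cis y)))\<^sup>2)"
  using assms(1)
proof (induction N arbitrary: a f)
  case 0
  show ?case
    \<comment> \<open>The split covers the default value: a non-integrable function has integral
      0.\<close>
    by (cases "(\<lambda>y. (cmod (f (of_real s * cis y)))\<^sup>2) integrable_on {0..2*pi}")
      (simp_all add: integral_nonneg not_integrable_integral)
next
  case (Suc N)
  define f1 where "f1 z = (\<Sum>n. a (Suc n) * z ^ n)" for z
  have f1: "(\<lambda>n. a (Suc n) * z ^ n) sums f1 z" if z: "z \<in> ball 0 1" for z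
  proof (cases "z = 0")
    case True
    then show ?thesis using powser_sums_zero[of "\<lambda>n. a (Suc n)"] by (simp add: f1_def sums_iff)
  next
    case False
    have "summable (\<lambda>n. a (Suc n) * z ^ Suc n)"
      using Suc.prems[OF z] sums_summable by (subst summable_Suc_iff[of "\<lambda>n. a n * z ^ n"]) blast
    then have "summable (\<lambda>n. (a (Suc n) * z ^ Suc n) / z)" by (rule summable_divide)
    then show ?thesis using False unfolding f1_def by (auto intro: summable_sums)
  qed
  have f_eq: "f z = a 0 + z * f1 z" if z: "z \<in> ball 0 1" for z
  proof -
    have "(\<lambda>n. a (Suc n) * z ^ Suc n) sums (z * f1 z)"
      using sums_mult[OF f1[OF z], of z] by (simp add: mult_ac)
    then have "(\<lambda>n. a n * z ^ n) sums (z * f1 z + a 0)" by (subst (asm) sums_Suc_iff) simp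
    then show ?thesis using Suc.prems[OF z] sums_unique2 by (metis add.commute)
  qed
  have hol: "f1 holomorphic_on ball 0 1"
    by (rule power_series_holomorphic[of _ _ "\<lambda>n. a (Suc n)"]) (use f1 in auto)
  have cont: "continuous_on {0..2*pi} (\<lambda>y. f1 (of_real s * cis y))"
  proof (rule continuous_on_compose2[of "ball 0 1" f1])
    show "continuous_on (ball 0 1) f1" using hol by (rule holomorphic_on_imp_continuous_on)
  qed (use s in \<open>auto intro!: continuous_intros simp: norm_mult\<close>)
  \<comment> \<open>Twice the real part of \<open>h\<close> is the cross term of |a 0 + z f1|^2; as
    \<open>h 0 = 0\<close>, its circle mean is zero.\<close>
  define h where "h z = cnj (a 0) * (z * f1 z)" for z
  have "((\<lambda>y. h (of_real s * cis y)) has_integral 2 * of_real pi * h 0) {0..2*pi}"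
    by (rule circle_mean_value) (use s in \<open>auto simp: h_def intro!: holomorphic_intros hol\<close>)
  from has_integral_linear[OF this bounded_linear_Re]
  have I1: "((\<lambda>y. Re (h (of_real s * cis y))) has_integral 0) {0..2*pi}"
    by (simp add: o_def h_def)
  have I2: "((\<lambda>y. (cmod (f1 (of_real s * cis y)))\<^sup>2) has_integral
      integral {0..2*pi} (\<lambda>y. (cmod (f1 (of_real s * cis y)))\<^sup>2)) {0..2*pi}" (is "(_ has_integral ?I) _")
    by (intro integrable_integral integrable_continuous_interval continuous_intros cont)
  have I3: "((\<lambda>y::real. (cmod (a 0))\<^sup>2) has_integral 2*pi*(cmod (a 0))\<^sup>2) {0..2*pi}"
    using has_integral_const_real[of "(cmod (a 0))\<^sup>2" 0 "2*pi"] by simp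
  have "((\<lambda>y. (cmod (a 0))\<^sup>2 + 2 * Re (h (of_real s * cis y)) + s\<^sup>2 * (cmod (f1 (of_real s * cis y)))\<^sup>2)
     has_integral (2*pi*(cmod (a 0))\<^sup>2 + 2 * 0 + s\<^sup>2 * ?I)) {0..2*pi}"
    by (intro has_integral_add has_integral_mult_right I1 I2 I3)
  moreover have "(cmod (a 0))\<^sup>2 + 2 * Re (h z) + s\<^sup>2 * (cmod (f1 z))\<^sup>2 = (cmod (f z))\<^sup>2"
    if "z = of_real s * cis y" for y z
  proof -
    have z: "cmod z = s" using that s by (simp add: norm_mult)
    have "(cmod (a 0 + z * f1 z))\<^sup>2 = (cmod (a 0))\<^sup>2 + 2 * Re (h z) + (cmod (z * f1 z))\<^sup>2"
      unfolding h_def cmod_power2 by (simp add: power2_eq_square algebra_simps)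
    then show ?thesis using z s f_eq[of z] by (simp add: norm_mult power_mult_distrib)
  qed
  ultimately have "((\<lambda>y. (cmod (f (of_real s * cis y)))\<^sup>2) has_integral (2*pi*(cmod (a 0))\<^sup>2 + s\<^sup>2 * ?I)) {0..2*pi}"
    by simp
  then have "integral {0..2*pi} (\<lambda>y. (cmod (f (of_real s * cis y)))\<^sup>2) = 2*pi*(cmod (a 0))\<^sup>2 + s\<^sup>2 * ?I"
    by (rule integral_unique)
  moreover have "s\<^sup>2 * (2 * pi * (\<Sum>n<N. (cmod (a (Suc n)))\<^sup>2 * s ^ (2 * n))) \<le> s\<^sup>2 * ?I"
    using Suc.IH[OF f1] by (intro mult_left_mono) auto
  moreover have "(\<Sum>n<Suc N. (cmod (a n))\<^sup>2 * s ^ (2 * n)) =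
     (cmod (a 0))\<^sup>2 + s\<^sup>2 * (\<Sum>n<N. (cmod (a (Suc n)))\<^sup>2 * s ^ (2 * n))"
    by (subst sum.lessThan_Suc_shift) (simp add: sum_distrib_left power2_eq_square mult_ac)
  ultimately show ?case by (simp add: algebra_simps)
qed

section \<open>Topology of the image of an annulus\<close>

text \<open>Because of the pole, the image of the punctured disc of radius \<open>\<rho>\<close>
  leaves \<open>E\<close>. Its only finite boundary points lie in the image of the circle, hence in
  \<open>E\<close>, so it covers the connected complement of \<open>E\<close>; injectivity then
  keeps all points with \<open>\<rho> \<le> cmod z\<close> out of that complement.\<close>

lemma univalent_outer_image_subset:
  fixes k :: "complex \<Rightarrow> complex"
  assumes hol: "k holomorphic_on ball 0 1"
    and inj: "inj_on (\<lambda>z. 1 / z + k z) (ball 0 1 - {0})"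
    and rho: "0 < \<rho>" "\<rho> < 1"
    and E: "bounded E" "convex E"
    and sphere: "\<And>z. cmod z = \<rho> \<Longrightarrow> 1 / z + k z \<in> E"
    and z: "\<rho> \<le> cmod z" "cmod z < 1"
  shows "1 / z + k z \<in> E"
proof (rule ccontr)
  define h where "h = (\<lambda>z. 1 / z + k z)"
  assume notE: "1 / z + k z \<notin> E"
  define W where "W = h ` (ball 0 \<rho> - {0})"
  \<comment> \<open>\<open>T\<close> is the graph of \<open>h\<close> with the denominator cleared.
    The equation fails at z = 0, so the pole drops out, the relation is closed, and projecting along
    the compact disc gives a closed image.\<close>
  define T where "T = {p \<in> cball 0 \<rho> \<times> UNIV. 1 + fst p * k (fst p) - snd p * fst p = 0}"
  have holh: "h holomorphic_on ball 0 \<rho> - {0}"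
    unfolding h_def using rho by (intro holomorphic_intros holomorphic_on_subset[OF hol]) auto
  have contk: "continuous_on (cball 0 \<rho>) k"
    by (rule continuous_on_subset[OF holomorphic_on_imp_continuous_on[OF hol]]) (use rho in auto)
  have "inj_on h (ball 0 \<rho> - {0})"
    unfolding h_def by (rule inj_on_subset[OF inj]) (use rho in auto)
  then have "open W"
    unfolding W_def by (intro open_mapping_thm3 holh) auto
  have "closed T"
    unfolding T_def
    by (rule continuous_closed_preimage_constant)
      (auto intro!: continuous_intros continuous_on_compose2[OF contk] closed_Times)
  then have "closed {w. \<exists>z. z \<in> cball 0 \<rho> \<and> (z, w) \<in> T}" (is "closed ?W'")
    by (intro closed_compact_projection) auto
  have "cball 0 \<rho> - {0} = (ball 0 \<rho> - {0}) \<union> sphere (0::complex) \<rho>"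
    using rho by auto
  then have "W \<union> h ` sphere 0 \<rho> = h ` (cball 0 \<rho> - {0})"
    unfolding W_def by (simp only: image_Un)
  also have "\<dots> = ?W'"
  proof (intro set_eqI iffI)
    fix w assume "w \<in> ?W'"
    then obtain z where z: "cmod z \<le> \<rho>" "1 + z * k z - w * z = 0" by (auto simp: T_def)
    then have "z \<noteq> 0" by auto
    moreover from this have "w = h z" using z(2) by (simp add: h_def field_simps)
    ultimately show "w \<in> h ` (cball 0 \<rho> - {0})" using z(1) by auto
  qed (auto simp: T_def h_def field_simps)
  finally have W': "?W' = W \<union> h ` sphere 0 \<rho>" ..
  have "compact (k ` cball 0 \<rho>)" by (intro compact_continuous_image contk) auto
  then obtain B where B: "\<And>z. z \<in> cball 0 \<rho> \<Longrightarrow> cmod (k z) \<le> B"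
    using compact_imp_bounded bounded_iff by (metis imageI)
  obtain R where R: "R > 0" "\<And>w. w \<in> E \<Longrightarrow> cmod w \<le> R"
    using E(1) bounded_pos by blast
  have "B \<ge> 0" using B[of 0] rho by (auto intro: order_trans[OF norm_ge_zero])
  \<comment> \<open>Small enough that |h(t)| \<ge> 1/t - B > R, so \<open>h\<close> takes a value
    outside \<open>E\<close> at the point \<open>t\<close> of the small disc.\<close>
  define t where "t = min (\<rho> / 2) (1 / (R + B + 1))"
  have t: "0 < t" "t < \<rho>" "R + B + 1 \<le> 1 / t"
  proof -
    have "t \<le> 1 / (R + B + 1)" "0 < t" "t < \<rho>" and pos: "R + B + 1 > 0"
      using rho R(1) \<open>B \<ge> 0\<close> by (auto simp: t_def)
    then show "0 < t" "t < \<rho>" "R + B + 1 \<le> 1 / t"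
      by (simp_all add: le_divide_eq mult.commute)
  qed
  have "cmod (1 / of_real t) - cmod (k (of_real t)) \<le> cmod (h (of_real t))"
    unfolding h_def by (rule norm_diff_ineq)
  moreover have "cmod (k (of_real t)) \<le> B" using B t by simp
  moreover have "cmod (1 / of_real t) = 1 / t" using t by (simp add: norm_divide)
  ultimately have "cmod (h (of_real t)) > R" using t by linarith
  then have tE: "h (of_real t) \<in> - E" using R(2) by force
  have tW: "h (of_real t) \<in> W" using t by (auto simp: W_def)
  \<comment> \<open>Inside the connected set \<open>- E\<close> the image \<open>W\<close> of the small punctured disc is both open and closed.\<close>
  have "connected (- E)"
    by (rule connected_complement_bounded_convex) (use E in auto)
  moreover have "W \<inter> - ?W' \<inter> - E = {}" using W' by auto
  moreover have "- E \<subseteq> W \<union> - ?W'" using W' sphere by (auto simp: h_def)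
  ultimately have "W \<inter> - E = {} \<or> - ?W' \<inter> - E = {}"
    using \<open>open W\<close> \<open>closed ?W'\<close> by (intro connectedD) auto
  then have "- E \<subseteq> ?W'" using tE tW by blast
  then have "h z \<in> W" using W' notE sphere by (auto simp: h_def)
  then obtain z' where "z' \<in> ball 0 \<rho> - {0}" "h z = h z'"
    unfolding W_def by blast
  then have z': "cmod z' < \<rho>" "z' \<noteq> 0" "h z = h z'" by auto
  moreover have "z \<noteq> 0" using z rho by auto
  ultimately have "z = z'"
    using inj_onD[OF inj, of z z'] z rho by (auto simp: h_def)
  then show False using z z' by simp
qed

section \<open>Plane areas of images of holomorphic maps\<close>

text \<open>The change of variables theorem of HOL-Analysis is stated for \<open>real^'n\<close> only, so plane areas
  are measured after transport along \<open>cvec\<close>.\<close>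

definition cvec :: "complex \<Rightarrow> real^2" where
  "cvec z = vector [Re z, Im z]"

definition vcomp :: "real^2 \<Rightarrow> complex" where
  "vcomp v = Complex (v $ 1) (v $ 2)"

lemma cvec_nth [simp]: "cvec z $ 1 = Re z" "cvec z $ 2 = Im z"
  by (simp_all add: cvec_def)

lemma vcomp_sel [simp]: "Re (vcomp v) = v $ 1" "Im (vcomp v) = v $ 2"
  by (simp_all add: vcomp_def)

lemma vcomp_cvec [simp]: "vcomp (cvec z) = z" and cvec_vcomp [simp]: "cvec (vcomp v) = v"
  by (simp_all add: complex_eq_iff vec_eq_iff forall_2)

lemma bounded_linear_cvec: "bounded_linear cvec"
  by (intro linear_conv_bounded_linear[THEN iffD1] linearI) (simp_all add: vec_eq_iff forall_2)

lemma bounded_linear_vcomp: "bounded_linear vcomp"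
  by (intro linear_conv_bounded_linear[THEN iffD1] linearI) (simp_all add: complex_eq_iff)

lemma norm_cvec [simp]: "norm (cvec z) = cmod z"
  by (simp add: norm_vec_def L2_set_def sum_2 cmod_def)

lemma norm_vcomp [simp]: "cmod (vcomp v) = norm v"
  using norm_cvec[of "vcomp v"] by simp

lemma cvec_cball: "cvec ` cball 0 r = cball 0 r"
proof -
  have "x \<in> cvec ` cball 0 r" if "x \<in> cball 0 r" for x
    using that by (intro image_eqI[of _ _ "vcomp x"]) auto
  then show ?thesis by auto
qed

text \<open>Covers both Jacobians used below: \<open>q = 0\<close> for a holomorphic map,
  \<open>p = 1\<close> for the map from a disc onto an ellipse.\<close>

lemma det_cvec_linear:
  "det (matrix (\<lambda>v. cvec (p * vcomp v + q * cnj (vcomp v)))) = (cmod p)\<^sup>2 - (cmod q)\<^sup>2"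
  unfolding det_2 matrix_def cmod_power2
  by (simp add: axis_def power2_eq_square algebra_simps)

text \<open>Links the change of variables on \<open>real^2\<close> with Fubini on
  \<open>real \<times> real\<close>; the identification of coordinates preserves boxes and their
  contents.\<close>

lemma real2_has_integral_prod:
  fixes F :: "real \<times> real \<Rightarrow> real"
  assumes "(F has_integral i) (cbox (a, c) (b, d))"
  shows "((\<lambda>v. F (v $ 1, v $ 2)) has_integral i) (cbox (cvec (Complex a c)) (cvec (Complex b d)))"
proof -
  define g :: "real^2 \<Rightarrow> real \<times> real" where "g v = (v $ 1, v $ 2)" for v
  define h :: "real \<times> real \<Rightarrow> real^2" where "h p = cvec (Complex (fst p) (snd p))" for p
  have hg: "h (g x) = x" and gh: "g (h y) = y" for x y
    by (simp_all add: g_def h_def vec_eq_iff forall_2)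
  have hi: "h ` cbox u v = cbox (h u) (h v)" for u v
  proof -
    have "x \<in> h ` cbox u v" if "x \<in> cbox (h u) (h v)" for x
      using that by (intro image_eqI[of _ _ "g x"]) (auto simp: hg[symmetric] h_def g_def mem_box_cart forall_2 cbox_Pair_eq
         vec_eq_iff mem_Times_iff split: prod.splits, cases u, cases v, auto)
    then show ?thesis
      by (cases u, cases v) (auto simp: h_def mem_box_cart forall_2 cbox_Pair_eq)
  qed
  have gi: "g ` cbox u v = cbox (g u) (g v)" for u v
  proof -
    have "h ` cbox (g u) (g v) = cbox u v" by (simp add: hi hg)
    then have "g ` cbox u v = g ` h ` cbox (g u) (g v)" by simp
    then show ?thesis by (simp add: image_image gh)
  qed
  have content: "measure lborel (g ` cbox u v) = 1 * measure lborel (cbox u v)" for u v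
  proof (cases "cbox u v = {}")
    case False
    then have "u $ 1 \<le> v $ 1" "u $ 2 \<le> v $ 2"
      by (simp_all add: interval_ne_empty_cart)
    then show ?thesis
      using False unfolding gi unfolding g_def content_Pair
      by (simp add: content_cbox_cart UNIV_2)
  qed simp
  have cg: "continuous (at x) g" for x
    unfolding g_def by (intro continuous_intros)
  have "((\<lambda>x. F (g x)) has_integral (1 / 1) *\<^sub>R i) (h ` cbox (a, c) (b, d))"
    by (rule has_integral_twiddle[OF zero_less_one hg gh cg _ _ content assms]) (use gi hi in blast)+
  then show ?thesis by (simp add: hi) (simp add: g_def h_def)
qed

text \<open>The Jacobian of \<open>H\<close> is |H'|^2, so the area of the injective image is a
  double integral, and \<open>p\<close> bounds its inner integrals from below. Injectivity is asked
  on the open box because logarithmic coordinates will identify two opposite sides.\<close>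

lemma holomorphic_area_lower_bound:
  assumes H: "H holomorphic_on S" "open S" and sub: "cbox (Complex a c) (Complex b d) \<subseteq> S"
    and inj: "inj_on H (box (Complex a c) (Complex b d))"
    and A: "H ` box (Complex a c) (Complex b d) \<subseteq> A" "cvec ` A \<in> lmeasurable"
    and p: "(p has_integral P) {a..b}"
      "\<And>x. x \<in> {a..b} \<Longrightarrow> p x \<le> integral {c..d} (\<lambda>y. (cmod (deriv H (Complex x y)))\<^sup>2)"
  shows "P \<le> measure lebesgue (cvec ` A)"
proof -
  define D where "D z = (cmod (deriv H z))\<^sup>2" for z
  define B where "B = box (cvec (Complex a c)) (cvec (Complex b d))"
  define f where "f = (\<lambda>v. cvec (H (vcomp v)))"
  have Bbox: "vcomp v \<in> box (Complex a c) (Complex b d)" if "v \<in> B" for v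
    using that by (simp add: B_def mem_box_cart forall_2 in_box_complex_iff)
  have BS: "vcomp v \<in> S" if "v \<in> B" for v
    using Bbox[OF that] sub box_subset_cbox by blast
  have contD: "continuous_on S D"
    unfolding D_def using H
    by (intro continuous_intros holomorphic_on_imp_continuous_on holomorphic_deriv) auto
  have contC: "continuous_on (cbox (a, c) (b, d)) (\<lambda>p. D (Complex (fst p) (snd p)))"
  proof (rule continuous_on_compose2[OF contD])
    show "continuous_on (cbox (a, c) (b, d)) (\<lambda>p. Complex (fst p) (snd p))"
      unfolding Complex_eq by (intro continuous_intros)
    show "(\<lambda>p. Complex (fst p) (snd p)) ` cbox (a, c) (b, d) \<subseteq> S"
    proof (intro image_subsetI)
      fix p assume "p \<in> cbox (a, c) (b, d)"
      then have "Complex (fst p) (snd p) \<in> cbox (Complex a c) (Complex b d)"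
        by (cases p) (simp add: in_cbox_complex_iff cbox_Pair_eq)
      then show "Complex (fst p) (snd p) \<in> S" using sub by blast
    qed
  qed
  define I where "I = integral (cbox (a, c) (b, d)) (\<lambda>p. D (Complex (fst p) (snd p)))"
  have "((\<lambda>p. D (Complex (fst p) (snd p))) has_integral I) (cbox (a, c) (b, d))"
    unfolding I_def by (intro integrable_integral integrable_continuous contC)
  then have "((\<lambda>v. D (vcomp v)) has_integral I) (cbox (cvec (Complex a c)) (cvec (Complex b d)))"
    using real2_has_integral_prod[of "\<lambda>p. D (Complex (fst p) (snd p))"] by (simp add: vcomp_def)
  then have I: "((\<lambda>v. D (vcomp v)) has_integral I) B"
    unfolding B_def by (simp add: has_integral_open_interval)
  have der: "(f has_derivative (\<lambda>v. cvec (deriv H (vcomp x) * vcomp v))) (at x within B)" if "x \<in> B" for x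
  proof -
    have "(H has_derivative (*) (deriv H (vcomp x))) (at (vcomp x))"
      using holomorphic_derivI[OF H BS[OF that]] by (simp add: has_field_derivative_def)
    moreover have "(vcomp has_derivative vcomp) (at x within B)"
      by (intro bounded_linear_imp_has_derivative bounded_linear_vcomp)
    ultimately have "((\<lambda>v. H (vcomp v)) has_derivative (\<lambda>v. deriv H (vcomp x) * vcomp v)) (at x within B)"
      using has_derivative_compose by blast
    then show ?thesis unfolding f_def
      by (rule bounded_linear.has_derivative[OF bounded_linear_cvec])
  qed
  have det: "\<bar>det (matrix (\<lambda>v. cvec (deriv H (vcomp x) * vcomp v)))\<bar> = D (vcomp x)" for x
    using det_cvec_linear[of "deriv H (vcomp x)" 0] by (simp add: D_def)
  have injf: "inj_on f B"
  proof (rule inj_onI)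
    fix x y assume xy: "x \<in> B" "y \<in> B" "f x = f y"
    then have "H (vcomp x) = H (vcomp y)" unfolding f_def by (metis vcomp_cvec)
    then have "vcomp x = vcomp y" using inj xy Bbox by (auto dest: inj_onD)
    then show "x = y" by (metis cvec_vcomp)
  qed
  have leb: "B \<in> sets lebesgue" unfolding B_def by auto
  have int: "(\<lambda>x. \<bar>det (matrix (\<lambda>v. cvec (deriv H (vcomp x) * vcomp v)))\<bar>) integrable_on B"
    unfolding det using I by blast
  have "measure lebesgue (f ` B) = I"
    using measure_differentiable_image_eq[OF leb der injf int] I unfolding det by (simp add: integral_unique)
  moreover have "f ` B \<in> lmeasurable"
    using measurable_differentiable_image_eq[OF leb der injf] int by blast
  moreover have "f ` B \<subseteq> cvec ` A" using A(1) Bbox by (auto simp: f_def)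
  ultimately have "I \<le> measure lebesgue (cvec ` A)"
    using A(2) by (metis measure_mono_fmeasurable fmeasurableD)
  moreover have "I = integral {a..b} (\<lambda>x. integral {c..d} (\<lambda>y. D (Complex x y)))"
    unfolding I_def using integral_prod_continuous[OF contC] by simp
  moreover have "P \<le> integral {a..b} (\<lambda>x. integral {c..d} (\<lambda>y. D (Complex x y)))"
  proof (rule has_integral_le[OF p(1)])
    have "continuous_on (cbox a b) (\<lambda>x. integral (cbox c d) (\<lambda>y. D (Complex x y)))"
      by (rule integral_continuous_on_param) (use contC in \<open>simp add: case_prod_beta cbox_Pair_eq\<close>)
    then show "((\<lambda>x. integral {c..d} (\<lambda>y. D (Complex x y))) has_integral
        integral {a..b} (\<lambda>x. integral {c..d} (\<lambda>y. D (Complex x y)))) {a..b}"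
      by (intro integrable_integral integrable_continuous_interval) simp
  qed (use p(2) in \<open>simp add: D_def\<close>)
  ultimately show ?thesis by simp
qed

section \<open>Enclosing the image in an ellipse\<close>

text \<open>The linear part has determinant 1 - |q|^2, which lies between 0 and 1, so it does not
  increase the area of the disc.\<close>

lemma measure_cvec_ellipse:
  fixes k0 q :: complex
  assumes q: "cmod q \<le> 1" and T: "0 \<le> T"
  defines "E \<equiv> (\<lambda>v. k0 + (v + q * cnj v)) ` cball 0 T"
  shows "cvec ` E \<in> lmeasurable" "measure lebesgue (cvec ` E) \<le> pi * T\<^sup>2"
proof -
  define L where "L = (\<lambda>v. cvec (1 * vcomp v + q * cnj (vcomp v)))"
  have L: "linear L"
    by (rule linearI) (simp_all add: L_def vec_eq_iff forall_2 algebra_simps)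
  have "cvec ` E = (\<lambda>v. cvec k0 + v) ` L ` cball 0 T"
    unfolding cvec_cball[symmetric] E_def L_def image_image
    by (simp add: vec_eq_iff forall_2 linear_add[OF bounded_linear.linear[OF bounded_linear_cvec]])
  moreover have "L ` cball 0 T \<in> lmeasurable"
    by (intro measurable_linear_image L) auto
  moreover have "measure lebesgue (L ` cball 0 T) = \<bar>det (matrix L)\<bar> * measure lebesgue (cball 0 T :: (real^2) set)"
    by (intro measure_linear_image L) auto
  moreover have "measure lebesgue (cball 0 T :: (real^2) set) = pi * T\<^sup>2"
    using T by (simp add: content_cball unit_ball_vol_2)
  moreover have "\<bar>det (matrix L)\<bar> \<le> 1"
    using q unfolding L_def det_cvec_linear by (simp add: power_le_one abs_le_iff)
  moreover have "\<bar>det (matrix L)\<bar> * (pi * T\<^sup>2) \<le> 1 * (pi * T\<^sup>2)"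
    by (intro mult_right_mono calculation) auto
  ultimately show "cvec ` E \<in> lmeasurable" "measure lebesgue (cvec ` E) \<le> pi * T\<^sup>2"
    by (simp_all add: measurable_translation measure_translation)
qed

text \<open>On |z| = \<rho> the linear term c z of \<open>k\<close> equals c \<rho>^2 cnj (1/z), so
  1/z + c z traces an ellipse exactly and only the quadratic remainder enlarges it. A disc would
  cost an error of order \<rho> in the radius, hence a bounded but non-vanishing error in the
  area.\<close>

lemma univalent_image_subset_ellipse:
  fixes k :: "complex \<Rightarrow> complex"
  assumes hol: "k holomorphic_on ball 0 1"
    and inj: "inj_on (\<lambda>z. 1 / z + k z) (ball 0 1 - {0})"
  shows "\<exists>M\<ge>0. \<exists>\<rho>0>0. \<forall>\<rho>. 0 < \<rho> \<and> \<rho> < \<rho>0 \<longrightarrow> (\<exists>q. cmod q \<le> 1 \<and>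
      (\<forall>z. \<rho> \<le> cmod z \<and> cmod z < 1 \<longrightarrow>
        1 / z + k z \<in> (\<lambda>v. k 0 + (v + q * cnj v)) ` cball 0 (1 / \<rho> + M * \<rho>\<^sup>2)))"
proof -
  \<comment> \<open>Dividing out z twice leaves \<open>k2\<close>, the coefficient of the quadratic
    Taylor remainder of \<open>k\<close>.\<close>
  define k1 where "k1 = (\<lambda>z. if z = 0 then deriv k 0 else (k z - k 0) / (z - 0))"
  define k2 where "k2 = (\<lambda>z. if z = 0 then deriv k1 0 else (k1 z - k1 0) / (z - 0))"
  have "k1 holomorphic_on ball 0 1" unfolding k1_def by (intro pole_lemma_open hol) auto
  then have "k2 holomorphic_on ball 0 1" unfolding k2_def by (intro pole_lemma_open) auto
  then have "continuous_on (cball 0 (1/2)) k2"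
    by (intro holomorphic_on_imp_continuous_on) (auto intro: holomorphic_on_subset)
  then have "compact (k2 ` cball 0 (1/2))" by (intro compact_continuous_image) auto
  then obtain M where M: "\<And>z. z \<in> cball 0 (1/2) \<Longrightarrow> cmod (k2 z) \<le> M"
    using compact_imp_bounded bounded_iff by (metis imageI)
  have "M \<ge> 0" using M[of 0] by (auto intro: order_trans[OF norm_ge_zero])
  define c where "c = deriv k 0"
  have k_eq: "k z = k 0 + c * z + z\<^sup>2 * k2 z" for z
    by (cases "z = 0") (simp_all add: k2_def k1_def c_def field_simps power2_eq_square)
  \<comment> \<open>Keeps |q| \<le> 1/2, so that |d| \<ge> 3/4 below, and keeps the circle inside
    the disc where \<open>M\<close> bounds \<open>k2\<close>.\<close>
  define \<rho>0 where "\<rho>0 = 1 / (2 * (1 + cmod c))"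
  have \<rho>0: "0 < \<rho>0" "\<rho>0 \<le> 1/2" "cmod c * \<rho>0 \<le> 1/2"
    by (simp_all add: \<rho>0_def field_simps add_pos_nonneg)
  define q where "q \<rho> = c * of_real (\<rho>\<^sup>2)" for \<rho> :: real
  have q: "cmod (q \<rho>) \<le> 1 / 2" if "0 < \<rho>" "\<rho> < \<rho>0" for \<rho>
  proof -
    have "\<rho> * \<rho> \<le> \<rho>0 * 1" using that \<rho>0 by (intro mult_mono) auto
    then have "cmod c * (\<rho> * \<rho>) \<le> cmod c * \<rho>0" by (intro mult_left_mono) auto
    then show ?thesis using \<rho>0 by (simp add: q_def norm_mult power2_eq_square)
  qed
  have "1 / z + k z \<in> (\<lambda>v. k 0 + (v + q \<rho> * cnj v)) ` cball 0 (1 / \<rho> + 2 * M * \<rho>\<^sup>2)"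
    if \<rho>: "0 < \<rho>" "\<rho> < \<rho>0" and z: "\<rho> \<le> cmod z" "cmod z < 1" for \<rho> z
  proof -
    define E where "E = (\<lambda>v. k 0 + (v + q \<rho> * cnj v)) ` cball 0 (1 / \<rho> + 2 * M * \<rho>\<^sup>2)"
    have lin: "linear (\<lambda>v. v + q \<rho> * cnj v)"
      by (rule linearI) (simp_all add: algebra_simps)
    have E_eq: "E = (\<lambda>v. k 0 + v) ` (\<lambda>v. v + q \<rho> * cnj v) ` cball 0 (1 / \<rho> + 2 * M * \<rho>\<^sup>2)"
      by (simp add: E_def image_image)
    have "1 / z + k z \<in> E"
    proof (rule univalent_outer_image_subset[OF hol inj _ _ _ _ _ z])
      show "convex E" unfolding E_eq
        by (intro convex_translation convex_linear_image lin) auto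
      have "compact E" unfolding E_eq image_image
        by (intro compact_continuous_image continuous_intros) auto
      then show "bounded E" by (rule compact_imp_bounded)
      show "1 / z + k z \<in> E" if z: "cmod z = \<rho>" for z
      proof -
        define u where "u = z\<^sup>2 * k2 z"
        define d where "d = 1 - q \<rho> * cnj (q \<rho>)"
        have d_eq: "d = of_real (1 - (cmod (q \<rho>))\<^sup>2)"
          unfolding d_def of_real_diff complex_norm_square by simp
        have "(cmod (q \<rho>))\<^sup>2 \<le> (1/2)\<^sup>2" using q[OF \<rho>] by (intro power_mono) auto
        then have d3: "cmod d \<ge> 3/4"
          unfolding d_eq norm_of_real by (simp add: power2_eq_square)
        then have dnz: "d \<noteq> 0" by auto
        have dc: "cnj d = d" by (simp add: d_def)
        \<comment> \<open>\<open>v\<close> is the preimage of \<open>1 / z + k z - k 0\<close> under \<open>v \<mapsto> v + q cnj v\<close>, whose inverse is \<open>w \<mapsto> (w - q cnj w) / d\<close>\<close>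
        define v where "v = 1 / z + (u - q \<rho> * cnj u) / d"
        have u: "cmod u \<le> M * \<rho>\<^sup>2"
          using M[of z] z \<rho> \<rho>0 by (simp add: u_def norm_mult norm_power mult.commute mult_left_mono)
        have "cmod (u - q \<rho> * cnj u) \<le> cmod u + cmod (q \<rho>) * cmod u"
          by (metis complex_mod_cnj norm_mult norm_triangle_ineq4)
        also have "\<dots> \<le> cmod u + 1/2 * cmod u"
          using q[OF \<rho>] by (intro add_left_mono mult_right_mono) auto
        finally have "cmod (u - q \<rho> * cnj u) \<le> 3/2 * (M * \<rho>\<^sup>2)" using u by linarith
        \<comment> \<open>The quotient of 3/2 by 3/4 is the factor 2 in the enlarged radius.\<close>
        then have "cmod ((u - q \<rho> * cnj u) / d) \<le> (3/2 * (M * \<rho>\<^sup>2)) / (3/4)"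
          unfolding norm_divide using d3 \<open>M \<ge> 0\<close> by (intro frac_le) auto
        then have "cmod v \<le> 1 / \<rho> + 2 * M * \<rho>\<^sup>2"
          unfolding v_def using z by (intro norm_triangle_le) (simp add: norm_divide)
        moreover have "1 / z + k z = k 0 + (v + q \<rho> * cnj v)"
        proof -
          have znz: "z \<noteq> 0" using z \<rho> by auto
          have "q \<rho> * cnj (1 / z) = c * z"
            using znz unfolding q_def z[symmetric] complex_norm_square
            by simp
          moreover have "(u - q \<rho> * cnj u) / d + q \<rho> * cnj ((u - q \<rho> * cnj u) / d) = u"
            using dnz by (simp add: dc add_divide_distrib[symmetric] divide_eq_eq) (simp add: d_def algebra_simps)
          ultimately show ?thesis
            unfolding v_def k_eq[of z] u_def[symmetric] complex_cnj_add distrib_left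
            by (simp add: algebra_simps)
        qed
        ultimately show ?thesis unfolding E_def by (intro image_eqI[of _ _ v]) auto
      qed
    qed (use \<rho> \<rho>0 in auto)
    then show ?thesis by (simp add: E_def)
  qed
  moreover have "cmod (q \<rho>) \<le> 1" if "0 < \<rho>" "\<rho> < \<rho>0" for \<rho>
    using q[OF that] by simp
  moreover have "0 \<le> 2 * M" using \<open>M \<ge> 0\<close> by simp
  ultimately show ?thesis using \<rho>0(1) by blast
qed

section \<open>The area theorem\<close>

text \<open>With z = exp w the annulus becomes a rectangle, and |H'| = |\<phi>| / |z| for the power
  series \<open>\<phi>\<close>, z^2 times the derivative of 1/z + k. Bessel's inequality on each
  circle, integrated over the logarithm of the radius, bounds the area below; the ellipse bounds it
  above.\<close>

lemma area_inequality_annulus: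
  fixes k :: "complex \<Rightarrow> complex" and b :: "nat \<Rightarrow> complex"
  assumes hol: "k holomorphic_on ball 0 1"
    and inj: "inj_on (\<lambda>z. 1 / z + k z) (ball 0 1 - {0})"
    and b: "\<And>z. z \<in> ball 0 1 \<Longrightarrow> (\<lambda>n. b n * z ^ n) sums deriv k z"
    and \<rho>: "0 < \<rho>" "\<rho> < r" "r < 1"
    and T: "0 \<le> T" "cmod q \<le> 1"
    and sub: "\<And>z. \<rho> \<le> cmod z \<Longrightarrow> cmod z < 1 \<Longrightarrow>
        1 / z + k z \<in> (\<lambda>v. k0 + (v + q * cnj v)) ` cball 0 T"
  shows "(1 / \<rho>\<^sup>2 - 1 / r\<^sup>2) +
      (\<Sum>n<N. (cmod (b n))\<^sup>2 / (n + 1) * (r ^ (2 * (n + 1)) - \<rho> ^ (2 * (n + 1)))) \<le> T\<^sup>2"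
proof -
  \<comment> \<open>The coefficients of \<open>\<phi>\<close>: -1 from the pole, a zero, then those
    of \<open>deriv k\<close> shifted by two.\<close>
  define a where "a = (\<lambda>n. case n of 0 \<Rightarrow> - 1 | Suc 0 \<Rightarrow> 0 | Suc (Suc m) \<Rightarrow> b m)"
  define \<phi> where "\<phi> z = - 1 + z\<^sup>2 * deriv k z" for z
  have a_simps: "a 0 = - 1" "a (Suc 0) = 0" "a (Suc (Suc n)) = b n" for n
    by (simp_all add: a_def)
  have \<phi>: "(\<lambda>n. a n * z ^ n) sums \<phi> z" if "z \<in> ball 0 1" for z
  proof -
    have "(\<lambda>n. a (Suc (Suc n)) * z ^ Suc (Suc n)) sums (z\<^sup>2 * deriv k z)"
      using sums_mult[OF b[OF that], of "z\<^sup>2"] by (simp add: a_simps power2_eq_square mult_ac)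
    then have "(\<lambda>n. a (Suc n) * z ^ Suc n) sums (z\<^sup>2 * deriv k z)"
      by (subst (asm) sums_Suc_iff) (simp add: a_simps)
    then show ?thesis
      by (subst (asm) sums_Suc_iff) (simp add: a_simps \<phi>_def)
  qed
  define h where "h = (\<lambda>z. 1 / z + k z)"
  define H where "H w = h (exp w)" for w
  define S where "S = {w. Re w < 0}"
  have "open S" unfolding S_def by (rule open_halfspace_Re_lt)
  have exp_S: "cmod (exp w) < 1" if "w \<in> S" for w using that by (simp add: S_def)
  have der: "(H has_field_derivative (\<phi> (exp w) / exp w)) (at w)" if "w \<in> S" for w
  proof -
    have "(k has_field_derivative deriv k (exp w)) (at (exp w))"
      by (rule holomorphic_derivI[OF hol]) (use exp_S[OF that] in auto)
    then have "(h has_field_derivative (- 1 / (exp w)\<^sup>2 + deriv k (exp w))) (at (exp w))"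
      unfolding h_def by (auto intro!: derivative_eq_intros simp: power2_eq_square)
    from DERIV_chain2[OF this DERIV_exp]
    have "(H has_field_derivative (- 1 / (exp w)\<^sup>2 + deriv k (exp w)) * exp w) (at w)"
      by (simp only: H_def[abs_def])
    moreover have "(- 1 / (exp w)\<^sup>2 + deriv k (exp w)) * exp w = \<phi> (exp w) / exp w"
      by (simp add: \<phi>_def field_simps power2_eq_square)
    ultimately show ?thesis by simp
  qed
  have derivH: "deriv H w = \<phi> (exp w) / exp w" if "w \<in> S" for w
    using der[OF that] by (rule DERIV_imp_deriv)
  have holH: "H holomorphic_on S"
    using der \<open>open S\<close> by (auto simp: holomorphic_on_open)
  have ln: "ln \<rho> < ln r" "ln r < 0" using \<rho> by auto
  define A where "A = (\<lambda>v. k0 + (v + q * cnj v)) ` cball 0 T"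
  \<comment> \<open>\<open>p x\<close> is the Bessel bound for |H'|^2 on the circle of radius
    \<open>exp x\<close>, and \<open>Q\<close> is an antiderivative of \<open>p\<close>.\<close>
  define p where "p x = 2 * pi * (exp (- 2 * x) + (\<Sum>n<N. (cmod (b n))\<^sup>2 * exp (real (2 * (n + 1)) * x)))" for x
  define Q where "Q x = pi * (- exp (- 2 * x) + (\<Sum>n<N. (cmod (b n))\<^sup>2 / (n + 1) * exp (real (2 * (n + 1)) * x)))" for x
  have "Q (ln r) - Q (ln \<rho>) \<le> measure lebesgue (cvec ` A)"
  proof (rule holomorphic_area_lower_bound[OF holH \<open>open S\<close>, where c = 0 and d = "2 * pi"])
    show "cbox (Complex (ln \<rho>) 0) (Complex (ln r) (2 * pi)) \<subseteq> S"
      using ln by (auto simp: S_def in_cbox_complex_iff)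
    show "inj_on H (box (Complex (ln \<rho>) 0) (Complex (ln r) (2 * pi)))"
    proof (rule inj_onI)
      fix w w' assume w: "w \<in> box (Complex (ln \<rho>) 0) (Complex (ln r) (2 * pi))"
        "w' \<in> box (Complex (ln \<rho>) 0) (Complex (ln r) (2 * pi))" and eq: "H w = H w'"
      then have "w \<in> S" "w' \<in> S" using ln by (auto simp: S_def in_box_complex_iff)
      then have "exp w = exp w'"
        using inj_onD[OF inj, of "exp w" "exp w'"] eq exp_S by (auto simp: H_def h_def)
      \<comment> \<open>The open box has height 2 pi, so the imaginary parts differ by less than the
        period of \<open>exp\<close>.\<close>
      then show "w = w'"
        by (rule exp_complex_eqI[rotated]) (use w in \<open>auto simp: in_box_complex_iff\<close>)
    qed
    show "H ` box (Complex (ln \<rho>) 0) (Complex (ln r) (2 * pi)) \<subseteq> A"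
    proof (intro image_subsetI)
      fix w assume w: "w \<in> box (Complex (ln \<rho>) 0) (Complex (ln r) (2 * pi))"
      then have "ln \<rho> \<le> Re w" "Re w < 0" using ln by (auto simp: in_box_complex_iff)
      then have "exp (ln \<rho>) \<le> exp (Re w)" "cmod (exp w) < 1" by simp_all
      then have "\<rho> \<le> cmod (exp w)" "cmod (exp w) < 1" using \<rho> by simp_all
      then show "H w \<in> A" unfolding H_def h_def A_def by (rule sub)
    qed
    show "cvec ` A \<in> lmeasurable" unfolding A_def by (intro measure_cvec_ellipse T)
    show "(p has_integral (Q (ln r) - Q (ln \<rho>))) {ln \<rho>..ln r}"
    proof (rule fundamental_theorem_of_calculus)
      fix x
      have "((\<lambda>x. (cmod (b n))\<^sup>2 / (n + 1) * exp (real (2 * (n + 1)) * x)) has_real_derivative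
          2 * ((cmod (b n))\<^sup>2 * exp (real (2 * (n + 1)) * x))) (at x)" for n
      proof -
        have d: "((\<lambda>x. c * exp (m * x)) has_real_derivative (c * m) * exp (m * x)) (at x)" for c m :: real
          by (rule DERIV_cong[OF DERIV_cmult[OF DERIV_fun_exp[OF DERIV_cmult[OF DERIV_ident]]]]) simp
        have eq: "(cmod (b n))\<^sup>2 / (n + 1) * real (2 * (n + 1)) = 2 * (cmod (b n))\<^sup>2"
          by (simp add: field_simps)
        show ?thesis
          using d[of "(cmod (b n))\<^sup>2 / (n + 1)" "real (2 * (n + 1))"] unfolding eq by (simp only: mult.assoc)
      qed
      moreover have "((\<lambda>x. - exp (- 2 * x)) has_real_derivative 2 * exp (- 2 * x)) (at x)"
        by (auto intro!: derivative_eq_intros)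
      ultimately have "(Q has_real_derivative pi * (2 * exp (- 2 * x) +
          (\<Sum>n<N. 2 * ((cmod (b n))\<^sup>2 * exp (real (2 * (n + 1)) * x))))) (at x)"
        unfolding Q_def by (intro DERIV_cmult DERIV_add DERIV_sum)
      then have "(Q has_real_derivative p x) (at x)"
        by (simp add: p_def sum_distrib_left algebra_simps)
      then show "(Q has_vector_derivative p x) (at x within {ln \<rho>..ln r})"
        by (simp add: has_real_derivative_iff_has_vector_derivative has_vector_derivative_at_within)
    qed (use ln in auto)
    fix x assume x: "x \<in> {ln \<rho>..ln r}"
    then have s: "0 < exp x" "exp x < 1" using ln by auto
    have "(cmod (deriv H (Complex x y)))\<^sup>2 = exp (- 2 * x) * (cmod (\<phi> (of_real (exp x) * cis y)))\<^sup>2" for y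
    proof -
      have "Complex x y \<in> S" using x ln by (auto simp: S_def)
      then have "cmod (deriv H (Complex x y)) = cmod (\<phi> (exp (Complex x y))) / exp x"
        by (simp add: derivH norm_divide)
      moreover have "exp (Complex x y) = of_real (exp x) * cis y"
        by (simp add: exp_eq_polar)
      moreover have "exp (- 2 * x) = 1 / (exp x)\<^sup>2"
        using exp_minus[of "2 * x"] by (simp add: exp_double inverse_eq_divide)
      ultimately show ?thesis by (simp add: power_divide)
    qed
    then have "integral {0..2*pi} (\<lambda>y. (cmod (deriv H (Complex x y)))\<^sup>2) =
        exp (- 2 * x) * integral {0..2*pi} (\<lambda>y. (cmod (\<phi> (of_real (exp x) * cis y)))\<^sup>2)"
      by simp
    \<comment> \<open>The two extra terms are \<open>a 0\<close> and \<open>a (Suc 0)\<close>, which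
      precede the \<open>N\<close> coefficients of \<open>deriv k\<close>.\<close>
    moreover have "2 * pi * (\<Sum>n<N+2. (cmod (a n))\<^sup>2 * exp x ^ (2 * n)) \<le>
        integral {0..2*pi} (\<lambda>y. (cmod (\<phi> (of_real (exp x) * cis y)))\<^sup>2)"
      by (rule power_series_Bessel_circle[OF \<phi> s])
    moreover have "p x = exp (- 2 * x) * (2 * pi * (\<Sum>n<N+2. (cmod (a n))\<^sup>2 * exp x ^ (2 * n)))"
    proof -
      have "(\<Sum>n<N+2. (cmod (a n))\<^sup>2 * exp x ^ (2 * n)) =
          1 + (\<Sum>n<N. (cmod (b n))\<^sup>2 * exp x ^ (2 * (n + 2)))"
        by (simp add: sum.lessThan_Suc_shift a_simps del: sum.lessThan_Suc power_Suc)
      moreover have "exp (real (2 * (n + 1)) * x) = exp (- 2 * x) * exp x ^ (2 * (n + 2))" for n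
        by (simp add: exp_of_nat_mult[symmetric] exp_add[symmetric] algebra_simps)
      ultimately show ?thesis
        unfolding p_def by (simp add: sum_distrib_left distrib_left mult_ac)
    qed
    ultimately show "p x \<le> integral {0..2*pi} (\<lambda>y. (cmod (deriv H (Complex x y)))\<^sup>2)"
      by simp
  qed
  also have "\<dots> \<le> pi * T\<^sup>2" unfolding A_def by (intro measure_cvec_ellipse T)
  finally have le: "Q (ln r) - Q (ln \<rho>) \<le> pi * T\<^sup>2" .
  have Q_ln: "Q (ln t) = pi * (- (1 / t\<^sup>2) + (\<Sum>n<N. (cmod (b n))\<^sup>2 / (n + 1) * t ^ (2 * (n + 1))))"
    if "0 < t" for t
  proof -
    have "exp (- 2 * ln t) = 1 / t\<^sup>2"
      using that exp_minus[of "2 * ln t"] by (simp add: exp_double inverse_eq_divide)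
    moreover have "exp (real m * ln t) = t ^ m" for m
      using that by (simp add: exp_of_nat_mult)
    ultimately show ?thesis unfolding Q_def by (simp only:)
  qed
  have "Q (ln r) - Q (ln \<rho>) = pi * ((1 / \<rho>\<^sup>2 - 1 / r\<^sup>2) +
      (\<Sum>n<N. (cmod (b n))\<^sup>2 / (n + 1) * (r ^ (2 * (n + 1)) - \<rho> ^ (2 * (n + 1)))))"
    using \<rho> by (simp only: Q_ln right_diff_distrib sum_subtractf) (simp add: algebra_simps)
  then show ?thesis using le by simp
qed

text \<open>As \<rho> tends to 0 the term 1/\<rho>^2 cancels against the squared radius of the
  ellipse, leaving 1/r^2; then r tends to 1. For k = sum c_n z^n one has b_n = (n+1) c_(n+1), so
  this is the classical sum n |c_n|^2 \<le> 1.\<close>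

theorem Gronwall_area_theorem:
  fixes k :: "complex \<Rightarrow> complex" and b :: "nat \<Rightarrow> complex"
  assumes hol: "k holomorphic_on ball 0 1"
    and inj: "inj_on (\<lambda>z. 1 / z + k z) (ball 0 1 - {0})"
    and b: "\<And>z. z \<in> ball 0 1 \<Longrightarrow> (\<lambda>n. b n * z ^ n) sums deriv k z"
  shows "(\<Sum>n<N. (cmod (b n))\<^sup>2 / (n + 1)) \<le> 1"
proof -
  obtain M \<rho>0 where M: "M \<ge> 0" and \<rho>0: "0 < \<rho>0"
    and sub: "\<And>\<rho>. 0 < \<rho> \<and> \<rho> < \<rho>0 \<Longrightarrow> \<exists>q. cmod q \<le> 1 \<and> (\<forall>z. \<rho> \<le> cmod z \<and> cmod z < 1 \<longrightarrow>
        1 / z + k z \<in> (\<lambda>v. k 0 + (v + q * cnj v)) ` cball 0 (1 / \<rho> + M * \<rho>\<^sup>2))"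
    using univalent_image_subset_ellipse[OF hol inj] by blast
  have *: "(\<Sum>n<N. (cmod (b n))\<^sup>2 / (n + 1) * r ^ (2 * (n + 1))) \<le> 1 / r\<^sup>2" if r: "0 < r" "r < 1" for r
  proof (rule tendsto_le[OF trivial_limit_at_right_real])
    have "((\<lambda>\<rho>. \<Sum>n<N. (cmod (b n))\<^sup>2 / (n + 1) * (r ^ (2 * (n + 1)) - \<rho> ^ (2 * (n + 1)))) \<longlongrightarrow>
        (\<Sum>n<N. (cmod (b n))\<^sup>2 / (n + 1) * (r ^ (2 * (n + 1)) - 0 ^ (2 * (n + 1))))) (at_right 0)"
      (is "(?f \<longlongrightarrow> ?l) _")
      by (intro tendsto_intros)
    then show "(?f \<longlongrightarrow> (\<Sum>n<N. (cmod (b n))\<^sup>2 / (n + 1) * r ^ (2 * (n + 1)))) (at_right 0)"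
      by simp
    have "((\<lambda>\<rho>. 1 / r\<^sup>2 + 2 * M * \<rho> + M\<^sup>2 * \<rho> ^ 4) \<longlongrightarrow> 1 / r\<^sup>2 + 2 * M * 0 + M\<^sup>2 * 0 ^ 4) (at_right 0)"
      by (intro tendsto_intros)
    then show "((\<lambda>\<rho>. 1 / r\<^sup>2 + 2 * M * \<rho> + M\<^sup>2 * \<rho> ^ 4) \<longlongrightarrow> 1 / r\<^sup>2) (at_right 0)"
      by simp
    have "eventually (\<lambda>\<rho>. \<rho> \<in> {0<..<min r \<rho>0}) (at_right 0)"
      using r \<rho>0 by (intro eventually_at_right_real) auto
    then show "eventually (\<lambda>\<rho>. ?f \<rho> \<le> 1 / r\<^sup>2 + 2 * M * \<rho> + M\<^sup>2 * \<rho> ^ 4) (at_right 0)"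
    proof eventually_elim
      case (elim \<rho>)
      then have \<rho>: "0 < \<rho>" "\<rho> < r" "\<rho> < \<rho>0" by auto
      obtain q where q: "cmod q \<le> 1" "\<And>z. \<rho> \<le> cmod z \<Longrightarrow> cmod z < 1 \<Longrightarrow>
          1 / z + k z \<in> (\<lambda>v. k 0 + (v + q * cnj v)) ` cball 0 (1 / \<rho> + M * \<rho>\<^sup>2)"
        using sub \<rho> by blast
      have "(1 / \<rho>\<^sup>2 - 1 / r\<^sup>2) + ?f \<rho> \<le> (1 / \<rho> + M * \<rho>\<^sup>2)\<^sup>2"
        by (rule area_inequality_annulus[OF hol inj b \<rho>(1,2) r(2) _ q]) (use \<rho> M in auto)
      moreover have "(1 / \<rho> + M * \<rho>\<^sup>2)\<^sup>2 = 1 / \<rho>\<^sup>2 + 2 * M * \<rho> + M\<^sup>2 * \<rho> ^ 4"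
        using \<rho> by (simp add: power2_eq_square field_simps eval_nat_numeral)
      ultimately show ?case by simp
    qed
  qed
  show ?thesis
  proof (rule tendsto_le[OF trivial_limit_at_left_real])
    have "((\<lambda>r. \<Sum>n<N. (cmod (b n))\<^sup>2 / (n + 1) * r ^ (2 * (n + 1))) \<longlongrightarrow>
        (\<Sum>n<N. (cmod (b n))\<^sup>2 / (n + 1) * 1 ^ (2 * (n + 1)))) (at_left 1)" (is "(?f \<longlongrightarrow> _) _")
      by (intro tendsto_intros)
    then show "(?f \<longlongrightarrow> (\<Sum>n<N. (cmod (b n))\<^sup>2 / (n + 1))) (at_left 1)" by simp
    have "((\<lambda>r. 1 / r\<^sup>2) \<longlongrightarrow> 1 / 1\<^sup>2) (at_left (1::real))" by (intro tendsto_intros) auto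
    then show "((\<lambda>r. 1 / r\<^sup>2) \<longlongrightarrow> 1) (at_left (1::real))" by simp
    have "eventually (\<lambda>r. r \<in> {0<..<1}) (at_left (1::real))"
      by (intro eventually_at_left_real) auto
    then show "eventually (\<lambda>r. ?f r \<le> 1 / r\<^sup>2) (at_left 1)"
      by eventually_elim (use * in auto)
  qed
qed

section \<open>From the area theorem to the two-point estimate\<close>

text \<open>Cauchy-Schwarz with weights sqrt (n+1): the area theorem bounds one factor, and the
  other is the series sum (n+1) t^(2n) = 1/(1 - t^2)^2.\<close>

lemma univalent_deriv_bound:
  fixes k :: "complex \<Rightarrow> complex"
  assumes hol: "k holomorphic_on ball 0 1"
    and inj: "inj_on (\<lambda>z. 1 / z + k z) (ball 0 1 - {0})"
    and z: "cmod z < 1"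
  shows "cmod (deriv k z) \<le> 1 / (1 - (cmod z)\<^sup>2)"
proof -
  define b where "b n = (deriv ^^ n) (deriv k) 0 / fact n" for n
  have b: "(\<lambda>n. b n * w ^ n) sums deriv k w" if "w \<in> ball 0 1" for w
    using holomorphic_power_series[of "deriv k" 0 1 w] holomorphic_deriv[OF hol] that
    by (simp add: b_def)
  define t where "t = cmod z"
  have t: "0 \<le> t" "t < 1" "t\<^sup>2 < 1" using z by (simp_all add: t_def power_less_one_iff abs_square_less_1)
  have geo: "(\<lambda>n. of_nat (Suc n) * (t\<^sup>2) ^ n) sums (1 / (1 - t\<^sup>2)\<^sup>2)"
    using t by (intro geometric_deriv_sums) auto
  have bound: "cmod (\<Sum>n<N. b n * z ^ n) \<le> 1 / (1 - t\<^sup>2)" for N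
  proof -
    have "cmod (\<Sum>n<N. b n * z ^ n) \<le> (\<Sum>n<N. (cmod (b n) / sqrt (n + 1)) * (sqrt (n + 1) * t ^ n))"
      by (intro order_trans[OF norm_sum] sum_mono) (simp add: norm_mult norm_power t_def)
    also have "\<dots> \<le> sqrt (\<Sum>n<N. (cmod (b n) / sqrt (n + 1))\<^sup>2) * sqrt (\<Sum>n<N. (sqrt (n + 1) * t ^ n)\<^sup>2)"
      using L2_set_mult_ineq[of "\<lambda>n. cmod (b n) / sqrt (n + 1)" "\<lambda>n. sqrt (n + 1) * t ^ n" "{..<N}"] t
      by (simp add: L2_set_def)
    also have "\<dots> \<le> sqrt 1 * sqrt (1 / (1 - t\<^sup>2)\<^sup>2)"
    proof (intro mult_mono real_sqrt_le_mono)
      show "(\<Sum>n<N. (cmod (b n) / sqrt (n + 1))\<^sup>2) \<le> 1"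
        using Gronwall_area_theorem[OF hol inj b, of N] by (simp add: power_divide)
      have "(\<Sum>n<N. (sqrt (n + 1) * t ^ n)\<^sup>2) = (\<Sum>n<N. of_nat (Suc n) * (t\<^sup>2) ^ n)"
        by (intro sum.cong) (simp_all add: power_mult_distrib power_mult[symmetric] mult.commute)
      also have "\<dots> \<le> (\<Sum>n. of_nat (Suc n) * (t\<^sup>2) ^ n)"
        by (rule sum_le_suminf[OF sums_summable[OF geo]]) auto
      finally show "(\<Sum>n<N. (sqrt (n + 1) * t ^ n)\<^sup>2) \<le> 1 / (1 - t\<^sup>2)\<^sup>2"
        using sums_unique[OF geo] by simp
    qed (auto intro: sum_nonneg)
    finally show ?thesis using t by (simp add: real_sqrt_divide)
  qed
  have "(\<lambda>N. cmod (\<Sum>n<N. b n * z ^ n)) \<longlonglongrightarrow> cmod (deriv k z)"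
    using b[of z] z by (intro tendsto_norm) (simp add: sums_def)
  then show ?thesis
    using bound unfolding t_def by (intro LIMSEQ_le_const2) auto
qed

text \<open>The normalisation makes k = 1/F - 1/z holomorphic at 0, 1/z + k = 1/F inherits
  injectivity, and the quantity to be bounded is - z^2 k'.\<close>

lemma univalent_one_point_bound:
  assumes hol: "F holomorphic_on ball 0 1" and inj: "inj_on F (ball 0 1)"
    and F0: "F 0 = 0" "deriv F 0 = 1" and z: "z \<noteq> 0" "cmod z < 1"
  shows "cmod (z\<^sup>2 * deriv F z / (F z)\<^sup>2 - 1) \<le> (cmod z)\<^sup>2 / (1 - (cmod z)\<^sup>2)"
proof -
  \<comment> \<open>\<open>G\<close> is F/z and \<open>P\<close> is z/F, with singularities filled
    in; as \<open>P 0 = 1\<close>, the difference quotient \<open>k\<close> is 1/F - 1/z away from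
    0.\<close>
  define G where "G = (\<lambda>z. if z = 0 then deriv F 0 else (F z - F 0) / (z - 0))"
  define P where "P z = inverse (G z)" for z
  define k where "k = (\<lambda>z. if z = 0 then deriv P 0 else (P z - P 0) / (z - 0))"
  have Fnz: "F w \<noteq> 0" if "w \<noteq> 0" "cmod w < 1" for w
    using inj_onD[OF inj, of w 0] that F0 by auto
  have Gnz: "G w \<noteq> 0" if "cmod w < 1" for w
    using Fnz[OF _ that] F0 by (simp add: G_def)
  have "G holomorphic_on ball 0 1" unfolding G_def by (intro pole_lemma_open hol) auto
  then have "P holomorphic_on ball 0 1"
    unfolding P_def by (intro holomorphic_intros) (use Gnz in auto)
  then have holk: "k holomorphic_on ball 0 1"
    unfolding k_def by (intro pole_lemma_open) auto
  have k_eq: "k w = 1 / F w - 1 / w" if "w \<in> ball 0 1 - {0}" for w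
    using that Fnz[of w] F0 by (simp add: k_def P_def G_def field_simps)
  have "inj_on (\<lambda>w. 1 / w + k w) (ball 0 1 - {0})"
  proof (rule inj_onI)
    fix v w assume vw: "v \<in> ball 0 1 - {0}" "w \<in> ball 0 1 - {0}" "1 / v + k v = 1 / w + k w"
    then have "F v = F w" by (simp add: k_eq)
    then show "v = w" using inj_onD[OF inj] vw by auto
  qed
  then have bound: "cmod (deriv k z) \<le> 1 / (1 - (cmod z)\<^sup>2)"
    by (rule univalent_deriv_bound[OF holk _ z(2)])
  have dF: "(F has_field_derivative deriv F z) (at z)"
    by (rule holomorphic_derivI[OF hol]) (use z in auto)
  have "((\<lambda>w. 1 / F w - 1 / w) has_field_derivative (1 / z\<^sup>2 - deriv F z / (F z)\<^sup>2)) (at z)"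
    using Fnz[OF z] z by (auto intro!: derivative_eq_intros dF simp: power2_eq_square)
  then have "(k has_field_derivative (1 / z\<^sup>2 - deriv F z / (F z)\<^sup>2)) (at z)"
    by (rule has_field_derivative_transform_within_open[of _ _ _ "ball 0 1 - {0}"])
      (use z k_eq in \<open>auto simp: open_delete\<close>)
  then have "deriv k z = 1 / z\<^sup>2 - deriv F z / (F z)\<^sup>2" by (rule DERIV_imp_deriv)
  then have "z\<^sup>2 * deriv F z / (F z)\<^sup>2 - 1 = - (z\<^sup>2 * deriv k z)"
    using z by (simp add: field_simps)
  then have "cmod (z\<^sup>2 * deriv F z / (F z)\<^sup>2 - 1) = (cmod z)\<^sup>2 * cmod (deriv k z)"
    by (simp add: norm_mult norm_power)
  also have "\<dots> \<le> (cmod z)\<^sup>2 * (1 / (1 - (cmod z)\<^sup>2))"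
    using bound by (intro mult_left_mono) auto
  finally show ?thesis by simp
qed

text \<open>The identity behind disc automorphisms: it keeps \<open>m\<close> and \<open>z\<close>
  below inside the disc and evaluates the final bound.\<close>

lemma Moebius_norm_identity:
  "(cmod (1 - cnj a * b))\<^sup>2 - (cmod (b - a))\<^sup>2 = (1 - (cmod a)\<^sup>2) * (1 - (cmod b)\<^sup>2)"
  unfolding cmod_power2 by (simp add: power2_eq_square algebra_simps)

lemma univalent_two_point_bound:
  assumes hol: "f holomorphic_on ball 0 1" and inj: "inj_on f (ball 0 1)"
    and zu: "cmod \<zeta> < 1" "cmod u < 1" "u \<noteq> \<zeta>"
  shows "cmod ((\<zeta> - u)\<^sup>2 * deriv f \<zeta> * deriv f u / (f u - f \<zeta>)\<^sup>2 - 1) \<le>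
    (cmod (u - \<zeta>))\<^sup>2 / ((1 - (cmod \<zeta>)\<^sup>2) * (1 - (cmod u)\<^sup>2))"
proof -
  \<comment> \<open>\<open>m\<close> moves 0 to \<open>\<zeta>\<close> and \<open>z\<close> to
    \<open>u\<close>. \<open>C\<close> is the derivative of f o m at 0, so \<open>F\<close> is the
    normalised Koebe transform of \<open>f\<close>.\<close>
  define m where "m w = (w + \<zeta>) / (1 + cnj \<zeta> * w)" for w
  define d where "d = 1 - cnj \<zeta> * \<zeta>"
  define C where "C = d * deriv f \<zeta>"
  define F where "F w = (f (m w) - f \<zeta>) / C" for w
  define e where "e = 1 - cnj \<zeta> * u"
  define z where "z = (u - \<zeta>) / e"
  have nz: "1 + cnj \<zeta> * w \<noteq> 0" if "cmod w < 1" for w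
  proof -
    have "cmod (cnj \<zeta> * w) < 1"
      using that zu mult_strict_mono'[of "cmod \<zeta>" 1 "cmod w" 1] by (simp add: norm_mult)
    then show ?thesis by (metis add_eq_0_iff norm_minus_cancel norm_one order_less_irrefl)
  qed
  have sq: "(cmod w)\<^sup>2 < 1" if "cmod w < 1" for w :: complex
    using that by (simp add: abs_square_less_1)
  have d: "d \<noteq> 0" using nz[of "- \<zeta>"] zu by (simp add: d_def)
  have e: "e \<noteq> 0" using nz[of "- u"] zu by (simp add: e_def)
  have m: "m w \<in> ball 0 1" if "cmod w < 1" for w
  proof -
    have "(cmod (1 + cnj \<zeta> * w))\<^sup>2 - (cmod (w + \<zeta>))\<^sup>2 > 0"
      using Moebius_norm_identity[of "- \<zeta>" w] sq[OF that] sq[OF zu(1)] by simp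
    then have "cmod (w + \<zeta>) < cmod (1 + cnj \<zeta> * w)"
      by (intro power2_less_imp_less[of _ "cmod (1 + cnj \<zeta> * w)"]) auto
    then show ?thesis using nz[OF that] by (simp add: m_def norm_divide)
  qed
  have dm: "(m has_field_derivative d / (1 + cnj \<zeta> * w)\<^sup>2) (at w)" if "cmod w < 1" for w
    unfolding m_def d_def using nz[OF that]
    by (auto intro!: derivative_eq_intros simp: power2_eq_square field_simps)
  have fz: "deriv f \<zeta> \<noteq> 0"
    by (rule holomorphic_injective_imp_regular[OF hol _ inj]) (use zu in auto)
  then have C: "C \<noteq> 0" using d by (simp add: C_def)
  have dF: "(F has_field_derivative deriv f (m w) * (d / (1 + cnj \<zeta> * w)\<^sup>2) / C) (at w)"
    if "cmod w < 1" for w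
  proof -
    have "(f has_field_derivative deriv f (m w)) (at (m w))"
      by (rule holomorphic_derivI[OF hol _ m[OF that]]) auto
    from DERIV_chain2[OF this dm[OF that]] show ?thesis
      unfolding F_def using C by (auto intro!: derivative_eq_intros)
  qed
  have m0: "m 0 = \<zeta>" by (simp add: m_def)
  have holF: "F holomorphic_on ball 0 1"
    using dF by (subst holomorphic_on_open) (simp, metis mem_ball_0)
  have injF: "inj_on F (ball 0 1)"
  proof (rule inj_onI)
    fix v w assume vw: "v \<in> ball 0 1" "w \<in> ball 0 1" "F v = F w"
    then have "f (m v) = f (m w)" using C by (simp add: F_def)
    then have "m v = m w" using inj_onD[OF inj] m vw by auto
    then have "(v + \<zeta>) * (1 + cnj \<zeta> * w) = (w + \<zeta>) * (1 + cnj \<zeta> * v)"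
      using nz vw by (simp add: m_def frac_eq_eq)
    then have "(v - w) * d = 0" by (simp add: d_def algebra_simps)
    then show "v = w" using d by simp
  qed
  have "deriv F 0 = 1"
    using DERIV_imp_deriv[OF dF[of 0]] d fz by (simp add: m0 C_def)
  moreover have "F 0 = 0" by (simp add: F_def m0)
  moreover have "z \<noteq> 0" using zu e by (simp add: z_def)
  moreover have "(cmod (u - \<zeta>))\<^sup>2 < (cmod e)\<^sup>2"
  proof -
    have "(1 - (cmod \<zeta>)\<^sup>2) * (1 - (cmod u)\<^sup>2) > 0" using sq zu by simp
    then show ?thesis using Moebius_norm_identity[of \<zeta> u] by (simp add: e_def)
  qed
  then have "cmod (u - \<zeta>) < cmod e" by (rule power2_less_imp_less) auto
  then have z: "cmod z < 1" using e by (simp add: z_def norm_divide)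
  ultimately have bound: "cmod (z\<^sup>2 * deriv F z / (F z)\<^sup>2 - 1) \<le> (cmod z)\<^sup>2 / (1 - (cmod z)\<^sup>2)"
    by (intro univalent_one_point_bound holF injF)
  have one: "1 + cnj \<zeta> * z = d / e"
    using e by (simp add: z_def d_def field_simps) (simp add: e_def algebra_simps)
  have "z + \<zeta> = u * d / e"
    using e by (simp add: z_def d_def field_simps) (simp add: e_def algebra_simps)
  then have mz: "m z = u" using d e by (simp add: m_def one)
  have "z\<^sup>2 * deriv F z / (F z)\<^sup>2 =
      z\<^sup>2 * (deriv f u * (d / (d / e)\<^sup>2) / C) / ((f u - f \<zeta>) / C)\<^sup>2"
    using DERIV_imp_deriv[OF dF[OF z]] by (simp add: F_def mz one)
  also have "\<dots> = (\<zeta> - u)\<^sup>2 * deriv f \<zeta> * deriv f u / (f u - f \<zeta>)\<^sup>2"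
  proof -
    \<comment> \<open>One factor \<open>C\<close> survives from the squared denominator and supplies
      \<open>deriv f \<zeta>\<close>.\<close>
    have "z\<^sup>2 * (d / (d / e)\<^sup>2) * C = (u - \<zeta>)\<^sup>2 * deriv f \<zeta>"
      using d e by (simp add: z_def C_def power2_eq_square field_simps)
    moreover have "z\<^sup>2 * (deriv f u * (d / (d / e)\<^sup>2) / C) / ((f u - f \<zeta>) / C)\<^sup>2 =
        (z\<^sup>2 * (d / (d / e)\<^sup>2) * C) * deriv f u / (f u - f \<zeta>)\<^sup>2"
      using C by (simp add: power2_eq_square)
    ultimately show ?thesis by (simp add: power2_commute)
  qed
  finally have "cmod ((\<zeta> - u)\<^sup>2 * deriv f \<zeta> * deriv f u / (f u - f \<zeta>)\<^sup>2 - 1) \<le>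
      (cmod z)\<^sup>2 / (1 - (cmod z)\<^sup>2)" using bound by simp
  also have "\<dots> = (cmod (u - \<zeta>))\<^sup>2 / ((cmod e)\<^sup>2 - (cmod (u - \<zeta>))\<^sup>2)"
    using e by (simp add: z_def norm_divide power_divide divide_simps)
  finally show ?thesis by (simp add: e_def Moebius_norm_identity)
qed

text \<open>r = sqrt 2 - 1 solves 2 r = 1 - r^2. Hence |u - \<zeta>| < 2 r = 1 - r^2, and its square
  is below the product (1 - |\<zeta>|^2)(1 - |u|^2).\<close>

lemma class_S_two_point_quot_bound:
  assumes f: "f \<in> class_S" and zu: "cmod \<zeta> < sqrt 2 - 1" "cmod u < sqrt 2 - 1"
  shows "cmod (two_point_quot f \<zeta> u - 1) < 1"
proof (cases "u = \<zeta>")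
  case False
  define r :: real where "r = sqrt 2 - 1"
  have r: "0 < r" "r < 1" "2 * r = 1 - r\<^sup>2"
    using sqrt2_less_2 by (simp_all add: r_def power2_eq_square algebra_simps)
  have hol: "f holomorphic_on ball 0 1" and inj: "inj_on f (ball 0 1)"
    using f by (auto simp: class_S_def class_A_def analytic_imp_holomorphic)
  have lt: "1 - r\<^sup>2 < 1 - (cmod w)\<^sup>2" if "cmod w < r" for w :: complex
    using that by (simp add: power_strict_mono)
  have "cmod (u - \<zeta>) < 1 - r\<^sup>2"
    using norm_triangle_ineq4[of u \<zeta>] zu r by (simp add: r_def)
  then have "(cmod (u - \<zeta>))\<^sup>2 < (1 - r\<^sup>2) * (1 - r\<^sup>2)"
    unfolding power2_eq_square[of "cmod (u - \<zeta>)"] by (intro mult_strict_mono') auto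
  moreover have "0 \<le> 1 - r\<^sup>2" using r by linarith
  then have "(1 - r\<^sup>2) * (1 - r\<^sup>2) < (1 - (cmod \<zeta>)\<^sup>2) * (1 - (cmod u)\<^sup>2)"
    using lt zu by (intro mult_strict_mono') (simp_all add: r_def)
  ultimately have *: "(cmod (u - \<zeta>))\<^sup>2 < (1 - (cmod \<zeta>)\<^sup>2) * (1 - (cmod u)\<^sup>2)"
    by (rule less_trans)
  moreover have "0 \<le> (cmod (u - \<zeta>))\<^sup>2" by simp
  ultimately have "0 < (1 - (cmod \<zeta>)\<^sup>2) * (1 - (cmod u)\<^sup>2)" by linarith
  with * have "(cmod (u - \<zeta>))\<^sup>2 / ((1 - (cmod \<zeta>)\<^sup>2) * (1 - (cmod u)\<^sup>2)) < 1"
    by (simp only: divide_less_eq_1_pos)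
  moreover have "cmod (two_point_quot f \<zeta> u - 1) \<le>
      (cmod (u - \<zeta>))\<^sup>2 / ((1 - (cmod \<zeta>)\<^sup>2) * (1 - (cmod u)\<^sup>2))"
    using univalent_two_point_bound[OF hol inj, of \<zeta> u] False zu r
    by (simp add: two_point_quot_def r_def)
  ultimately show ?thesis by linarith
qed (simp add: two_point_quot_def)

section \<open>Sharpness of the radius\<close>

definition extremal :: "complex \<Rightarrow> complex" where
  "extremal z = z / (1 - z\<^sup>2)"

lemma one_minus_square_nz: "1 - z\<^sup>2 \<noteq> 0" if "cmod z < 1" for z :: complex
proof
  assume "1 - z\<^sup>2 = 0"
  then have "z\<^sup>2 = 1" by simp
  then have "(cmod z)\<^sup>2 = 1" by (metis norm_power norm_one)
  with that show False by (simp add: abs_square_eq_1)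
qed

lemma extremal_has_derivative:
  assumes "cmod z < 1"
  shows "(extremal has_field_derivative (1 + z\<^sup>2) / (1 - z\<^sup>2)\<^sup>2) (at z)"
  unfolding extremal_def[abs_def] using one_minus_square_nz[OF assms]
  by (auto intro!: derivative_eq_intros simp: power2_eq_square algebra_simps)

lemma deriv_extremal: "cmod z < 1 \<Longrightarrow> deriv extremal z = (1 + z\<^sup>2) / (1 - z\<^sup>2)\<^sup>2"
  by (rule DERIV_imp_deriv[OF extremal_has_derivative])

text \<open>Equality of two values factors as (z - w)(1 + z w) = 0, and |z w| < 1 rules out the
  second factor.\<close>

lemma extremal_class_S: "extremal \<in> class_S"
proof -
  have "extremal holomorphic_on ball 0 1"
    using extremal_has_derivative by (subst holomorphic_on_open) (simp, metis mem_ball_0)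
  moreover have "inj_on extremal (ball 0 1)"
  proof (rule inj_onI)
    fix z w :: complex assume zw: "z \<in> ball 0 1" "w \<in> ball 0 1" "extremal z = extremal w"
    then have "z * (1 - w\<^sup>2) = w * (1 - z\<^sup>2)"
      using one_minus_square_nz by (simp add: extremal_def frac_eq_eq)
    then have "(z - w) * (1 + z * w) = 0" by (simp add: power2_eq_square algebra_simps)
    moreover have "1 + z * w \<noteq> 0"
    proof
      assume "1 + z * w = 0"
      then have "z * w = - 1" by (simp add: add_eq_0_iff)
      then have "cmod z * cmod w = 1" by (metis norm_mult norm_minus_cancel norm_one)
      moreover have "cmod z * cmod w < 1 * 1"
        using zw by (intro mult_strict_mono') auto
      ultimately show False by simp
    qed
    ultimately show "z = w" by simp
  qed
  ultimately show ?thesis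
    by (simp add: class_S_def class_A_def analytic_on_open deriv_extremal) (simp add: extremal_def)
qed

text \<open>Here z/f = 1 - z^2, and the expression defining the class is exactly z^2.\<close>

lemma extremal_class_U: "extremal \<in> class_U"
proof -
  have "cmod ((quot_id extremal z)\<^sup>2 * deriv extremal z - 1) < 1" if "cmod z < 1" for z
  proof -
    have "quot_id extremal z = 1 - z\<^sup>2" by (simp add: quot_id_def extremal_def)
    then have "(quot_id extremal z)\<^sup>2 * deriv extremal z - 1 = z\<^sup>2"
      using one_minus_square_nz[OF that] by (simp add: deriv_extremal[OF that])
    then show ?thesis using that by (simp add: norm_power abs_square_less_1)
  qed
  then show ?thesis using extremal_class_S by (simp add: class_U_def)
qed

text \<open>At r and -r the quotient is ((1 + r^2)/(1 - r^2))^2, and the inner fraction reaches sqrt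
  2 exactly at r = sqrt 2 - 1.\<close>

lemma extremal_two_point_quot:
  assumes r: "sqrt 2 - 1 < r" "r < 1"
  shows "cmod (two_point_quot extremal (of_real r) (- of_real r) - 1) \<ge> 1"
proof -
  have r0: "0 < r" using r(1) real_sqrt_ge_one[of 2] by linarith
  define w where "w = complex_of_real r"
  have w: "cmod w < 1" "w \<noteq> 0" "cmod (- w) < 1" using r r0 by (simp_all add: w_def)
  have "(2 * w)\<^sup>2 * (B / A\<^sup>2) * (B / A\<^sup>2) / (- w / A - w / A)\<^sup>2 = (B / A)\<^sup>2"
    if "A \<noteq> 0" for A B
    using w that by (simp add: power2_eq_square field_simps)
  from this[OF one_minus_square_nz[OF w(1)]]
  have "two_point_quot extremal w (- w) = ((1 + w\<^sup>2) / (1 - w\<^sup>2))\<^sup>2"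
    using w deriv_extremal[OF w(1)] deriv_extremal[OF w(3)]
    by (simp add: two_point_quot_def extremal_def)
  then have eq: "two_point_quot extremal w (- w) - 1 = of_real (((1 + r\<^sup>2) / (1 - r\<^sup>2))\<^sup>2 - 1)"
    by (simp add: w_def)
  have "1 - r\<^sup>2 > 0" using r r0 by (simp add: abs_square_less_1)
  have "(sqrt 2 - 1)\<^sup>2 < r\<^sup>2" using r by (intro power_strict_mono) auto
  \<comment> \<open>Since (1 + sqrt 2)(sqrt 2 - 1) = 1, the left side is sqrt 2 - 1, and the
    inequality rearranges to the next line.\<close>
  then have "(1 + sqrt 2) * (sqrt 2 - 1)\<^sup>2 \<le> (1 + sqrt 2) * r\<^sup>2"
    by (intro mult_left_mono) auto
  then have "sqrt 2 * (1 - r\<^sup>2) \<le> 1 + r\<^sup>2" by (simp add: power2_eq_square algebra_simps)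
  then have "sqrt 2 \<le> (1 + r\<^sup>2) / (1 - r\<^sup>2)" using \<open>1 - r\<^sup>2 > 0\<close> by (simp add: le_divide_eq)
  then have "(sqrt 2)\<^sup>2 \<le> ((1 + r\<^sup>2) / (1 - r\<^sup>2))\<^sup>2" by (rule power_mono) auto
  then show ?thesis unfolding w_def[symmetric] eq norm_of_real by simp
qed

theorem theorem3:
  shows "(\<forall>f \<in> class_S \<union> class_U. \<forall>\<zeta> u :: complex.
            cmod \<zeta> < sqrt 2 - 1 \<longrightarrow> cmod u < sqrt 2 - 1 \<longrightarrow>
            cmod (two_point_quot f \<zeta> u - 1) < 1) \<and>
         (\<forall>F \<in> {class_S, class_U}.
            \<not> (\<exists>R :: real. sqrt 2 - 1 < R \<and> R \<le> 1 \<and>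
                 (\<forall>f \<in> F. \<forall>\<zeta> u :: complex.
                    cmod \<zeta> < R \<longrightarrow> cmod u < R \<longrightarrow>
                    cmod (two_point_quot f \<zeta> u - 1) < 1)))"
proof (intro conjI)
  show "\<forall>f \<in> class_S \<union> class_U. \<forall>\<zeta> u. cmod \<zeta> < sqrt 2 - 1 \<longrightarrow> cmod u < sqrt 2 - 1 \<longrightarrow>
      cmod (two_point_quot f \<zeta> u - 1) < 1"
    using class_S_two_point_quot_bound by (auto simp: class_U_def)
next
  have False if F: "F \<in> {class_S, class_U}" and R: "sqrt 2 - 1 < R" "R \<le> 1"
    and le: "\<forall>f \<in> F. \<forall>\<zeta> u. cmod \<zeta> < R \<longrightarrow> cmod u < R \<longrightarrow> cmod (two_point_quot f \<zeta> u - 1) < 1" for F R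
  proof -
    \<comment> \<open>A point strictly between the two radii is admissible for \<open>R\<close> and,
      as \<open>R \<le> 1\<close>, lies in the disc.\<close>
    obtain r where r: "sqrt 2 - 1 < r" "r < R" using dense[OF R(1)] by blast
    moreover have "1 \<le> sqrt (2::real)" by simp
    ultimately have "\<bar>r\<bar> < R" by linarith
    then have "cmod (of_real r) < R" "cmod (- of_real r) < R" by simp_all
    moreover have "extremal \<in> F" using F extremal_class_S extremal_class_U by auto
    ultimately have "cmod (two_point_quot extremal (of_real r) (- of_real r) - 1) < 1"
      using le by blast
    then show False using extremal_two_point_quot[of r] r R by simp
  qed
  then show "\<forall>F \<in> {class_S, class_U}. \<not> (\<exists>R. sqrt 2 - 1 < R \<and> R \<le> 1 \<and>
      (\<forall>f \<in> F. \<forall>\<zeta> u. cmod \<zeta> < R \<longrightarrow> cmod u < R \<longrightarrow> cmod (two_point_quot f \<zeta> u - 1) < 1))"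
    by blast
qed

end
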